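(* Let $\mathcal{V}=\{V_1,\dots,V_k\}$ be a collection of subsets of $[n]=\{1,\dots,n\}$. If the matroid $M(\mathcal{V})$ is a positroid, then the factors of $R(\mathcal{V})$ vanish on the boundary of the positroid variety $\Sigma(\mathcal{V})$; that is, the vanishing locus in $L(\mathcal{V})$ of each factor of $R(\mathcal{V})$ is contained in $\overline{\Sigma(\mathcal{V})}\setminus\Sigma(\mathcal{V})$.
   Context: Variable valued matrix: let $\mathbf{x}=\{x_{i,j}\}$ be algebraically independent variables. $M_{\mathcal{V}}$ is the $k\times n$ matrix with $(i,j)$ entry $x_{i,j}$ if $j\in V_i$ and $0$ otherwise. $M(\mathcal{V})$ is the matroid on $[n]$ given by linear independence of the columns of $M_{\mathcal{V}}$ (with the entries $x_{i,j}$ algebraically independent). Let $\mathrm{Gr}_{\mathbb{R}}(k,n)$ be the real Grassmannian of $k$-planes in $\mathbb{R}^n$. $L(\mathcal{V})\subseteq\mathrm{Gr}_{\mathbb{R}}(k,n)$ is the set of row spaces of all full rank real matrices obtained by setting the variables of $M_{\mathcal{V}}$ to real values. Positroids: a positroid is a matroid on the cyclically ordered set $[n]$ that can be represented by a real matrix all of whose maximal minors are nonnegative. For $a\in[n]$ let $<_a$ be the order $a<_a a+1<_a\dots<_a a-1$ on $[n]$; it induces the Gale order on $k$-subsets: $\{s_1<_a\dots<_a s_k\}\le_a\{t_1<_a\dots<_a t_k\}$ iff $s_i\le_a t_i$ for all $i$. The Grassmann necklace of a positroid of rank $k$ is $\mathcal{I}=\{I_1,\dots,I_n\}$ where $I_a$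 is the $\le_a$-minimal basis. For a positroid $M(\mathcal{V})$ with Grassmann necklace $\mathcal{I}$, the closed positroid variety $\overline{\Sigma(\mathcal{V})}\subseteq\mathrm{Gr}_{\mathbb{R}}(k,n)$ is defined by the vanishing of all Plücker coordinates $\Delta_I$ with $I_b\not\le_b I$ for some $b\in[n]$, and the open positroid variety $\Sigma(\mathcal{V})$ is the subset of $\overline{\Sigma(\mathcal{V})}$ where $\Delta_{I_1},\dots,\Delta_{I_n}$ are all nonzero. The boundary of $\Sigma(\mathcal{V})$ is $\overline{\Sigma(\mathcal{V})}\setminus\Sigma(\mathcal{V})$. The polynomial $R(\mathcal{V})$: let $\Delta_{I_i}(\mathbf{x})\in\mathbb{R}[\mathbf{x}]$ be the maximal minor of $M_{\mathcal{V}}$ with columns $I_i$. Then $R(\mathcal{V})=\mathrm{rad}\big(\prod_{i=1}^n\Delta_{I_i}(\mathbf{x})\big)$, i.e. the product of the distinct prime factors of $\prod_i\Delta_{I_i}(\mathbf{x})$ in $\mathbb{R}[\mathbf{x}]$. The vanishing locus in $L(\mathcal{V})$ of a polynomial in $\mathbf{x}$ is the set of row spaces of full rank real evaluations of $M_{\mathcal{V}}$ at points where the polynomial is zero. *)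

theory Defs
  imports
    "Jordan_Normal_Form.DL_Rank_Submatrix"
    "HOL-Library.Poly_Mapping"
    "HOL-Library.Product_Lexorder"
    "HOL-Computational_Algebra.Fraction_Field"
begin

text \<open>
  Rows and columns of matrices are counted from \<open>0\<close>, so the cyclically ordered ground set
  \<open>[n] = {1, \<dots>, n}\<close> appears as \<open>{..<n}\<close>, and a collection \<open>V\<^sub>1, \<dots>, V\<^sub>k\<close> of subsets of
  \<open>[n]\<close> as a family \<open>V\<close> of subsets of \<open>{..<n}\<close> indexed by \<open>{..<k}\<close>; repetitions are allowed.
\<close>

subsection \<open>Real polynomials in the variables \<open>x\<^sub>i\<^sub>j\<close>\<close>

text \<open>
  A monomial is a finitely supported exponent function, a polynomial a finitely supported
  coefficient function.  There is a variable for every pair of natural numbers, so this ring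
  contains \<open>\<real>[x]\<close> for all \<open>k\<close> and \<open>n\<close>; a divisor of a nonzero polynomial
  involves only variables of that polynomial, so nothing changes for divisibility.
\<close>

type_synonym mpoly = "(nat \<times> nat \<Rightarrow>\<^sub>0 nat) \<Rightarrow>\<^sub>0 real"

definition var :: "nat \<times> nat \<Rightarrow> mpoly" where
  "var v = Poly_Mapping.single (Poly_Mapping.single v 1) 1"

definition eval_mpoly :: "(nat \<times> nat \<Rightarrow> real) \<Rightarrow> mpoly \<Rightarrow> real" where
  "eval_mpoly x p =
     (\<Sum>m \<in> Poly_Mapping.keys p. Poly_Mapping.lookup p m *
        (\<Prod>v \<in> Poly_Mapping.keys m. x v ^ Poly_Mapping.lookup m v))"

text \<open>
  Among the nonzero scalar multiples of a polynomial, exactly one is monic for the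
  lexicographic order on monomials.  Hence the monic prime divisors of \<open>p \<noteq> 0\<close> are its
  distinct prime factors, one from each class of associated ones.
\<close>

definition monic_mpoly :: "mpoly \<Rightarrow> bool" where
  "monic_mpoly p \<longleftrightarrow> p \<noteq> 0 \<and> Poly_Mapping.lookup p (Max (Poly_Mapping.keys p)) = 1"

definition rad :: "mpoly \<Rightarrow> mpoly" where
  "rad p = \<Prod>{q. prime_elem q \<and> monic_mpoly q \<and> q dvd p}"

subsection \<open>Matroids of columns, positroids and Grassmann necklaces\<close>

text \<open>A matroid is given by its set of independent sets.\<close>

definition column_matroid :: "'a::field mat \<Rightarrow> nat set set" where
  "column_matroid A =
     {J. J \<subseteq> {..<dim_col A} \<and> inj_on (col A) J \<and>
         \<not> module.lin_dep class_ring (module_vec TYPE('a) (dim_row A)) (col A ` J)}"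

definition matroid_bases :: "nat set set \<Rightarrow> nat set set" where
  "matroid_bases M = {B \<in> M. \<forall>J \<in> M. B \<subseteq> J \<longrightarrow> J = B}"

definition maximal_minor :: "'a::comm_ring_1 mat \<Rightarrow> nat set \<Rightarrow> 'a" where
  "maximal_minor A I = det (submatrix A UNIV I)"

text \<open>
  The representing matrix must have full row rank: otherwise all its maximal minors are zero,
  and every real representable matroid would qualify.
\<close>

definition positroid :: "nat \<Rightarrow> nat set set \<Rightarrow> bool" where
  "positroid n M \<longleftrightarrow>
     (\<exists>d. \<exists>A \<in> carrier_mat d n.
        vec_space.rank d (A :: real mat) = d \<and>
        (\<forall>I \<subseteq> {..<n}. card I = d \<longrightarrow> 0 \<le> maximal_minor A I) \<and>
        column_matroid A = M)"

text \<open>The position of \<open>j\<close> in the order \<open>a <\<^sub>a a + 1 <\<^sub>a \<dots> <\<^sub>a a - 1\<close> of the ground set.\<close>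

definition cyclic_pos :: "nat \<Rightarrow> nat \<Rightarrow> nat \<Rightarrow> nat" where
  "cyclic_pos n a j = (j + n - a) mod n"

definition gale_le :: "nat \<Rightarrow> nat \<Rightarrow> nat set \<Rightarrow> nat set \<Rightarrow> bool" where
  "gale_le n a S T \<longleftrightarrow>
     list_all2 (\<le>) (sorted_list_of_set (cyclic_pos n a ` S))
                   (sorted_list_of_set (cyclic_pos n a ` T))"

definition necklace :: "nat \<Rightarrow> nat set set \<Rightarrow> nat \<Rightarrow> nat set" where
  "necklace n M a =
     (THE B. B \<in> matroid_bases M \<and> (\<forall>B' \<in> matroid_bases M. gale_le n a B B'))"

subsection \<open>The Grassmannian and positroid varieties\<close>

definition Gr :: "nat \<Rightarrow> nat \<Rightarrow> real vec set set" where
  "Gr k n =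
     {W. VectorSpace.subspace class_ring W (module_vec TYPE(real) n) \<and>
         vectorspace.dim class_ring ((module_vec TYPE(real) n)\<lparr>carrier := W\<rparr>) = k}"

text \<open>
  Plucker coordinates are defined up to a common nonzero scalar, as the maximal minors of any
  matrix with row space \<open>W\<close>.  Only their vanishing is needed; for \<open>W \<in> Gr k n\<close> it does not
  depend on the matrix.
\<close>

definition plucker_zero :: "nat \<Rightarrow> nat \<Rightarrow> real vec set \<Rightarrow> nat set \<Rightarrow> bool" where
  "plucker_zero k n W I \<longleftrightarrow>
     (\<exists>A \<in> carrier_mat k n. vec_space.row_space n A = W \<and> maximal_minor A I = 0)"

definition closed_positroid_variety ::
    "nat \<Rightarrow> nat \<Rightarrow> nat set set \<Rightarrow> real vec set set" where
  "closed_positroid_variety k n M =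
     {W \<in> Gr k n. \<forall>I \<subseteq> {..<n}. card I = k \<longrightarrow>
        (\<exists>b < n. \<not> gale_le n b (necklace n M b) I) \<longrightarrow> plucker_zero k n W I}"

definition open_positroid_variety ::
    "nat \<Rightarrow> nat \<Rightarrow> nat set set \<Rightarrow> real vec set set" where
  "open_positroid_variety k n M =
     {W \<in> closed_positroid_variety k n M. \<forall>a < n. \<not> plucker_zero k n W (necklace n M a)}"

subsection \<open>Variable valued matrices\<close>

definition var_mat :: "nat \<Rightarrow> nat \<Rightarrow> (nat \<Rightarrow> nat set) \<Rightarrow> mpoly mat" where
  "var_mat k n V = mat k n (\<lambda>(i, j). if j \<in> V i then var (i, j) else 0)"

text \<open>Linear independence of the columns is taken over the field \<open>\<real>(x)\<close> of rational functions.\<close>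

definition var_matroid :: "nat \<Rightarrow> nat \<Rightarrow> (nat \<Rightarrow> nat set) \<Rightarrow> nat set set" where
  "var_matroid k n V =
     column_matroid (map_mat (\<lambda>p. Fraction_Field.Fract p 1) (var_mat k n V))"

definition R_poly :: "nat \<Rightarrow> nat \<Rightarrow> (nat \<Rightarrow> nat set) \<Rightarrow> mpoly" where
  "R_poly k n V =
     rad (\<Prod>a<n. maximal_minor (var_mat k n V) (necklace n (var_matroid k n V) a))"

definition vanishing_locus ::
    "nat \<Rightarrow> nat \<Rightarrow> (nat \<Rightarrow> nat set) \<Rightarrow> mpoly \<Rightarrow> real vec set set" where
  "vanishing_locus k n V f =
     {vec_space.row_space n (map_mat (eval_mpoly x) (var_mat k n V)) | x.
        vec_space.rank k (map_mat (eval_mpoly x) (var_mat k n V)) = k \<and> eval_mpoly x f = 0}"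

end

theory Submission
  imports Defs
begin

text \<open>
  For every \<open>a\<close> the \<open>\<le>\<^sub>a\<close>-minimal basis exists in any matroid, so a set \<open>I\<close> that fails
  \<open>I\<^sub>b \<le>\<^sub>b I\<close> for some \<open>b\<close> is not a basis, and its minor vanishes identically in \<open>x\<close>: all
  evaluations lie in the closed variety.  If a factor of \<open>R\<close> vanishes at \<open>x\<close>, so does some
  prime factor of the product of the minors \<open>\<Delta>\<close> at \<open>I\<^sub>1, \<dots>, I\<^sub>n\<close>, hence one of these minors,
  and the row space is not in the open variety.
\<close>

subsection \<open>Evaluation of polynomials\<close>

text \<open>Updating a key outside the support is the same as adding a \<open>single\<close>, and
  every finitely supported function is built from 0 by such updates. Additive identities thereby
  reduce to single terms.\<close>

lemma poly_mapping_single_induct: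
  assumes "P 0" "\<And>f k c. P f \<Longrightarrow> P (f + Poly_Mapping.single k c)"
  shows "P (p :: 'a \<Rightarrow>\<^sub>0 'b::comm_monoid_add)"
proof (induction p rule: update_induct)
  case const
  show ?case by (rule assms(1))
next
  case (update f k c)
  have "Poly_Mapping.update k c f = f + Poly_Mapping.single k c"
    using update.hyps
    by (intro poly_mapping_eqI) (auto simp: lookup_update lookup_add lookup_single in_keys_iff)
  then show ?case using assms(2) update.IH by metis
qed

definition eval_monomial :: "(nat \<times> nat \<Rightarrow> real) \<Rightarrow> (nat \<times> nat \<Rightarrow>\<^sub>0 nat) \<Rightarrow> real" where
  "eval_monomial x m = (\<Prod>v \<in> Poly_Mapping.keys m. x v ^ Poly_Mapping.lookup m v)"

text \<open>Exponents off the support are 0 and contribute factors 1; so two monomials can be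
  evaluated over a common index set.\<close>

lemma eval_monomial_superset:
  assumes "finite S" "Poly_Mapping.keys m \<subseteq> S"
  shows "eval_monomial x m = (\<Prod>v\<in>S. x v ^ Poly_Mapping.lookup m v)"
  unfolding eval_monomial_def
  by (rule prod.mono_neutral_left[OF assms]) (simp add: in_keys_iff)

lemma eval_monomial_0: "eval_monomial x 0 = 1"
  by (simp add: eval_monomial_def)

lemma eval_monomial_add: "eval_monomial x (m + m') = eval_monomial x m * eval_monomial x m'"
proof -
  let ?S = "Poly_Mapping.keys m \<union> Poly_Mapping.keys m'"
  have "Poly_Mapping.keys (m + m') \<subseteq> ?S" by (rule keys_add)
  then show ?thesis
    by (simp add: eval_monomial_superset[of ?S] lookup_add power_add prod.distrib)
qed

lemma eval_mpoly_altdef: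
  "eval_mpoly x p = (\<Sum>m \<in> Poly_Mapping.keys p. Poly_Mapping.lookup p m * eval_monomial x m)"
  by (simp add: eval_mpoly_def eval_monomial_def)

lemma eval_mpoly_single: "eval_mpoly x (Poly_Mapping.single m c) = c * eval_monomial x m"
  by (simp add: eval_mpoly_altdef)

lemma eval_mpoly_0: "eval_mpoly x 0 = 0"
  by (simp add: eval_mpoly_altdef)

lemma eval_mpoly_1: "eval_mpoly x 1 = 1"
  by (simp add: eval_mpoly_altdef eval_monomial_0)

lemma eval_mpoly_add: "eval_mpoly x (p + q) = eval_mpoly x p + eval_mpoly x q"
  unfolding eval_mpoly_altdef
  by (rule setsum_keys_plus_distrib[where f = "\<lambda>m c. c * eval_monomial x m"])
     (simp_all add: distrib_right)

text \<open>Both sides are additive in \<open>p\<close> and in \<open>q\<close>, so nested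
  inductions reduce the claim to two single terms, where exponents add.\<close>

lemma eval_mpoly_mult: "eval_mpoly x (p * q) = eval_mpoly x p * eval_mpoly x q"
proof (induction p rule: poly_mapping_single_induct)
  case 1
  show ?case by (simp add: eval_mpoly_0)
next
  case (2 f k c)
  have "eval_mpoly x (Poly_Mapping.single k c * q) = c * eval_monomial x k * eval_mpoly x q"
    by (induction q rule: poly_mapping_single_induct)
       (simp_all add: eval_mpoly_0 eval_mpoly_add eval_mpoly_single distrib_left mult_single
          eval_monomial_add)
  with 2 show ?case by (simp add: distrib_right eval_mpoly_add eval_mpoly_single)
qed

lemma comm_ring_hom_eval_mpoly: "comm_ring_hom (eval_mpoly x)"
  by unfold_locales (simp_all add: eval_mpoly_0 eval_mpoly_1 eval_mpoly_add eval_mpoly_mult)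

lemma eval_mpoly_prod: "eval_mpoly x (\<Prod>i\<in>S. g i) = (\<Prod>i\<in>S. eval_mpoly x (g i))"
  by (induction S rule: infinite_finite_induct) (simp_all add: eval_mpoly_1 eval_mpoly_mult)

lemma eval_mpoly_dvd:
  assumes "p dvd q" "eval_mpoly x p = 0"
  shows "eval_mpoly x q = 0"
  using assms by (auto simp: dvd_def eval_mpoly_mult)

text \<open>A zero of a product of divisors of \<open>p\<close> is a zero of one of them, hence of
  its multiple \<open>p\<close>.\<close>

lemma eval_mpoly_rad_eq_0:
  assumes "eval_mpoly x (rad p) = 0"
  shows "eval_mpoly x p = 0"
proof -
  let ?Q = "{q. prime_elem q \<and> monic_mpoly q \<and> q dvd p}"
  have prod0: "(\<Prod>q\<in>?Q. eval_mpoly x q) = 0"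
    using assms by (simp add: rad_def eval_mpoly_prod)
  \<comment> \<open>A product over an infinite set is 1 by convention, so the value 0 forces
    finiteness.\<close>
  then have "finite ?Q"
    by (metis (no_types, lifting) prod.infinite zero_neq_one)
  with prod0 obtain q where "q dvd p" "eval_mpoly x q = 0"
    by (auto simp: prod_zero_iff)
  then show ?thesis by (rule eval_mpoly_dvd)
qed

subsection \<open>Maximal minors\<close>

text \<open>Applied to two homomorphisms: evaluation at a point and the embedding into the fraction
  field.\<close>

lemma maximal_minor_hom:
  assumes "comm_ring_hom h"
  shows "maximal_minor (map_mat h A) I = h (maximal_minor A I)"
proof -
  interpret comm_ring_hom h by (rule assms)
  have "submatrix (map_mat h A) UNIV I = map_mat h (submatrix A UNIV I)"
    by (rule eq_matI) (auto simp: submatrix_def pick_UNIV pick_le)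
  then show ?thesis by (simp add: maximal_minor_def)
qed

lemma comm_ring_hom_Fract: "comm_ring_hom (\<lambda>p :: 'a::idom. Fraction_Field.Fract p 1)"
  by unfold_locales (simp_all add: fract_collapse)

lemma Fract_eq_zero_iff: "Fraction_Field.Fract (p :: 'a::idom) 1 = 0 \<longleftrightarrow> p = 0"
  by (simp add: fract_expand(1) eq_fract(1) del: fract_collapse)

lemma set_cols_submatrix:
  assumes "I \<subseteq> {..<dim_col A}"
  shows "set (cols (submatrix A UNIV I)) = col A ` I"
proof -
  let ?S = "submatrix A UNIV I"
  have I: "{j. j < dim_col A \<and> j \<in> I} = I" using assms by auto
  have fin: "finite I" using assms finite_subset by blast
  have col: "col ?S j = col A (pick I j)" if "j < card I" for j
    using that pick_le[of j "dim_col A" I]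
    by (intro eq_vecI) (auto simp: submatrix_def I pick_UNIV)
  have "pick I ` {0..<card I} = I"
  proof
    show "pick I ` {0..<card I} \<subseteq> I" using pick_in_set by auto
    show "I \<subseteq> pick I ` {0..<card I}"
    proof
      fix i assume i: "i \<in> I"
      \<comment> \<open>The number of smaller elements of \<open>I\<close> is the index at which
        \<open>pick\<close> enumerates \<open>i\<close>.\<close>
      then have "card {a \<in> I. a < i} < card I"
        using fin by (intro psubset_card_mono) auto
      then show "i \<in> pick I ` {0..<card I}"
        using pick_card_in_set[OF i] by force
    qed
  qed
  moreover have "set (cols ?S) = (\<lambda>j. col A (pick I j)) ` {0..<card I}"
    by (auto simp: cols_def dim_submatrix I col)
  ultimately show ?thesis by (metis image_image)
qed

lemma col_in_carrier_vec: "A \<in> carrier_mat k n \<Longrightarrow> col A ` J \<subseteq> carrier_vec k"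
  using col_dim[of A] by auto

text \<open>A nonzero minor makes its \<open>k\<close> columns independent, and a
  \<open>k\<close>-dimensional space has no larger independent set. The contrapositive is what
  matters later: minors at non-bases vanish.\<close>

lemma basis_if_maximal_minor_nonzero:
  fixes A :: "'a::field mat"
  assumes A: "A \<in> carrier_mat k n" and I: "I \<subseteq> {..<n}" "card I = k"
    and minor: "maximal_minor A I \<noteq> 0"
  shows "I \<in> matroid_bases (column_matroid A)"
proof -
  interpret vec_space "TYPE('a)" k .
  let ?S = "submatrix A UNIV I"
  have dims: "dim_row A = k" "dim_col A = n" using A by auto
  have "{j. j < n \<and> j \<in> I} = I" using I by auto
  then have S: "?S \<in> carrier_mat k k"
    using I by (intro carrier_matI) (simp_all add: dim_submatrix dims)
  have full_rank: "rank ?S = k"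
    using low_rank_det_zero[OF S] minor by (simp add: maximal_minor_def)
  then have dist: "distinct (cols ?S)"
    using non_distinct_low_rank[OF S] by auto
  have cols: "set (cols ?S) = col A ` I"
    by (rule set_cols_submatrix) (use I dims in auto)
  have "lin_indpt (col A ` I)"
    using full_rank_lin_indpt[OF S full_rank dist] cols by simp
  moreover have "card (col A ` I) = card I"
    using distinct_card[OF dist] S I by (simp add: cols)
  then have "inj_on (col A) I"
    using I finite_subset by (intro eq_card_imp_inj_on) auto
  ultimately have indep: "I \<in> column_matroid A"
    using I by (simp add: column_matroid_def dims)
  have "J = I" if J: "J \<in> column_matroid A" "I \<subseteq> J" for J
  proof -
    from J have J': "J \<subseteq> {..<n}" "inj_on (col A) J" "lin_indpt (col A ` J)"
      by (simp_all add: column_matroid_def dims)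
    have "card J = card (col A ` J)" using J' by (simp add: card_image)
    also have "\<dots> \<le> k"
      using li_le_dim(2)[OF fin_dim _ J'(3)] col_in_carrier_vec[OF A] by (simp add: dim_is_n)
    finally show "J = I"
      using I J' J(2) by (metis card_seteq finite_lessThan finite_subset)
  qed
  with indep show ?thesis by (auto simp: matroid_bases_def)
qed

subsection \<open>Gale-minimal bases\<close>

locale finite_matroid =
  fixes E :: "nat set" and M :: "nat set set"
  assumes finite_ground: "finite E"
    and indep_subset_ground: "J \<in> M \<Longrightarrow> J \<subseteq> E"
    and indep_empty: "{} \<in> M"
    and indep_subset: "J \<in> M \<Longrightarrow> I \<subseteq> J \<Longrightarrow> I \<in> M"
    and augment: "I \<in> M \<Longrightarrow> J \<in> M \<Longrightarrow> card I < card J \<Longrightarrow> \<exists>e\<in>J - I. insert e I \<in> M"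
begin

lemma indep_finite: "J \<in> M \<Longrightarrow> finite J"
  using indep_subset_ground finite_ground finite_subset by blast

lemma card_indep_le_basis:
  assumes "B \<in> matroid_bases M" "J \<in> M"
  shows "card J \<le> card B"
proof (rule ccontr)
  assume "\<not> card J \<le> card B"
  then obtain e where "e \<in> J - B" "insert e B \<in> M"
    using augment[of B J] assms by (auto simp: matroid_bases_def)
  then show False using assms by (auto simp: matroid_bases_def)
qed

lemma card_basis_eq:
  "B \<in> matroid_bases M \<Longrightarrow> B' \<in> matroid_bases M \<Longrightarrow> card B = card B'"
  using card_indep_le_basis by (intro antisym) (auto simp: matroid_bases_def)

text \<open>Take a largest independent set between \<open>I\<close> and \<open>I \<union> B\<close>.
  If it were smaller than \<open>B\<close>, augmenting it from \<open>B\<close> would enlarge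
  it.\<close>

lemma basis_extending:
  assumes I: "I \<in> M" and B: "B \<in> matroid_bases M"
  obtains J where "J \<in> matroid_bases M" "I \<subseteq> J" "J \<subseteq> I \<union> B"
proof -
  let ?P = "\<lambda>J. J \<in> M \<and> I \<subseteq> J \<and> J \<subseteq> I \<union> B"
  have "\<forall>J. ?P J \<longrightarrow> card J < Suc (card B)"
    using card_indep_le_basis[OF B] by (simp add: less_Suc_eq_le)
  then obtain J where J: "?P J" and max: "\<And>J'. ?P J' \<Longrightarrow> card J' \<le> card J"
    using ex_has_greatest_nat[of ?P I card "Suc (card B)"] I by blast
  have card: "card B \<le> card J"
  proof (rule ccontr)
    assume "\<not> card B \<le> card J"
    then obtain e where e: "e \<in> B - J" "insert e J \<in> M"
      using augment[of J B] J B by (auto simp: matroid_bases_def)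
    then have "card (insert e J) \<le> card J"
      using J by (intro max) auto
    then show False using e J indep_finite by auto
  qed
  have "J' = J" if "J' \<in> M" "J \<subseteq> J'" for J'
    using that card card_indep_le_basis[OF B that(1)] indep_finite
    by (metis card_seteq le_trans)
  with J have "J \<in> matroid_bases M" by (auto simp: matroid_bases_def)
  with J show ?thesis using that by blast
qed

lemma ex_basis: "\<exists>B. B \<in> matroid_bases M"
proof -
  have "\<forall>J. J \<in> M \<longrightarrow> card J < Suc (card E)"
    using indep_subset_ground finite_ground by (simp add: card_mono less_Suc_eq_le)
  then obtain B where B: "B \<in> M" and max: "\<And>J. J \<in> M \<Longrightarrow> card J \<le> card B"
    using ex_has_greatest_nat[of "\<lambda>J. J \<in> M" "{}" card "Suc (card E)"] indep_empty by blast
  have "J = B" if "J \<in> M" "B \<subseteq> J" for J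
    using that max indep_finite by (metis card_seteq)
  with B show ?thesis by (auto simp: matroid_bases_def)
qed

text \<open>
  A basis of minimal total weight: if another basis had more elements of weight at most \<open>t\<close>,
  augmentation would exchange an element of weight above \<open>t\<close> for one of weight at most \<open>t\<close>.
\<close>

lemma ex_dominating_basis:
  fixes w :: "nat \<Rightarrow> nat"
  shows "\<exists>B\<in>matroid_bases M. \<forall>B'\<in>matroid_bases M. \<forall>t.
           card {x\<in>B'. w x \<le> t} \<le> card {x\<in>B. w x \<le> t}"
proof -
  obtain B where B: "B \<in> matroid_bases M"
    and min: "\<And>J. J \<in> matroid_bases M \<Longrightarrow> sum w B \<le> sum w J"
    using ex_has_least_nat[of "\<lambda>B. B \<in> matroid_bases M" _ "sum w"] ex_basis by blast
  have BM: "B \<in> M" "finite B" using B indep_finite by (auto simp: matroid_bases_def)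
  have "card {x\<in>B'. w x \<le> t} \<le> card {x\<in>B. w x \<le> t}" if B': "B' \<in> matroid_bases M" for B' t
  proof (rule ccontr)
    let ?I = "{x\<in>B. w x \<le> t}" and ?I' = "{x\<in>B'. w x \<le> t}"
    assume "\<not> card ?I' \<le> card ?I"
    moreover have "?I \<in> M" "?I' \<in> M"
      using B B' by (auto simp: matroid_bases_def intro: indep_subset)
    ultimately obtain e where e: "e \<in> ?I' - ?I" "insert e ?I \<in> M"
      using augment[of ?I ?I'] by auto
    obtain J where J: "J \<in> matroid_bases M" "insert e ?I \<subseteq> J" "J \<subseteq> insert e ?I \<union> B"
      using basis_extending[OF e(2) B] .
    have eB: "e \<notin> B" "w e \<le> t" using e by auto
    have Je: "J - {e} \<subseteq> B" using J by auto
    have "finite J" using J indep_finite by (auto simp: matroid_bases_def)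
    then have card_Je: "card B = Suc (card (J - {e}))"
      using card_basis_eq[OF J(1) B] J(2) by (metis card_Suc_Diff1 insert_subset)
    have "\<not> B \<subseteq> J"
    proof
      assume "B \<subseteq> J"
      then have "J - {e} = B" using Je eB by auto
      then show False using card_Je by simp
    qed
    then obtain y where y: "y \<in> B" "y \<notin> J" by blast
    \<comment> \<open>Bases have equal size, so \<open>J\<close> arises from \<open>B\<close> by
      exchanging exactly \<open>y\<close> for \<open>e\<close>.\<close>
    have Beq: "J - {e} = B - {y}"
      using Je y BM card_Je by (intro card_subset_eq) (auto simp: card_Diff_singleton)
    \<comment> \<open>\<open>J\<close> contains every element of \<open>B\<close> of weight at most
      \<open>t\<close>, so the removed \<open>y\<close> is heavier.\<close>
    have "t < w y" using y J(2) by auto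
    have "sum w J = w e + sum w (B - {y})"
      using J(2) \<open>finite J\<close> Beq by (metis insert_subset sum.remove)
    also have "\<dots> < w y + sum w (B - {y})" using eB \<open>t < w y\<close> by simp
    also have "\<dots> = sum w B" using y BM by (simp add: sum.remove)
    finally show False using min[OF J(1)] by simp
  qed
  with B show ?thesis by blast
qed

end

section \<open>The columns of a matrix form a matroid\<close>

text \<open>Augmentation is Steinitz exchange: if no element of \<open>J\<close> extends
  \<open>I\<close>, the columns of \<open>J\<close> lie in the span of those of \<open>I\<close>, so
  \<open>J\<close> is no larger than \<open>I\<close>.\<close>

lemma finite_matroid_column_matroid:
  fixes A :: "'a::field mat"
  assumes A: "A \<in> carrier_mat k n"
  shows "finite_matroid {..<n} (column_matroid A)"
proof
  interpret vec_space "TYPE('a)" k .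
  have dims: "dim_row A = k" "dim_col A = n" using A by auto
  note mem = column_matroid_def[of A, unfolded dims]
  show "finite {..<n}" by simp
  show "J \<subseteq> {..<n}" if "J \<in> column_matroid A" for J
    using that by (simp add: mem)
  show "{} \<in> column_matroid A"
    by (simp add: mem lin_dep_def)
  show "I \<in> column_matroid A" if "J \<in> column_matroid A" "I \<subseteq> J" for I J
    using that subset_li_is_li[of "col A ` J" "col A ` I"]
    by (auto simp: mem intro: inj_on_subset)
  show "\<exists>e\<in>J - I. insert e I \<in> column_matroid A"
    if IJ: "I \<in> column_matroid A" "J \<in> column_matroid A" "card I < card J" for I J
  proof (rule ccontr)
    assume no_ext: "\<not> ?thesis"
    have fin: "finite I" "finite J" using IJ finite_subset by (auto simp: mem)
    have carr: "col A ` S \<subseteq> carrier_vec k" for S by (rule col_in_carrier_vec[OF A])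
    have "col A ` J \<subseteq> span (col A ` I)"
    proof clarify
      fix e assume e: "e \<in> J"
      show "col A e \<in> span (col A ` I)"
      \<comment> \<open>Distinct indices may carry equal columns. Once \<open>col A e\<close> is
        new, injectivity persists on \<open>insert e I\<close>, and only linear dependence can
        prevent the extension.\<close>
      proof (cases "col A e \<in> col A ` I")
        case True
        then show ?thesis using in_own_span carr by auto
      next
        case False
        then have "e \<notin> I" by auto
        then have "insert e I \<notin> column_matroid A" using no_ext e by auto
        moreover have "insert e I \<subseteq> {..<n}" "inj_on (col A) (insert e I)"
          using IJ e False by (auto simp: mem)
        ultimately have "lin_dep (insert (col A e) (col A ` I))"
          by (simp add: mem)
        then show ?thesis
          using lin_dep_iff_in_span[of "col A ` I" "col A e"] False IJ carr[of I] carr[of "{e}"]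
          by (auto simp: mem)
      qed
    qed
    moreover have J: "lin_indpt (col A ` J)" "inj_on (col A) J" and I: "inj_on (col A) I"
      using IJ by (simp_all add: mem)
    \<comment> \<open>\<open>C\<close> completes the columns of \<open>J\<close> to a spanning set;
      only the nonnegativity of its size is used.\<close>
    ultimately obtain C :: "'a vec set" where
      "int (card C) \<le> int (card (col A ` I)) - int (card (col A ` J))"
      using replacement[OF finite_imageI[OF fin(2)] finite_imageI[OF fin(1)], of "col A" "col A"]
        carr[of I]
      by auto
    then have "card (col A ` J) \<le> card (col A ` I)" by linarith
    then show False using IJ(3) I J(2) by (simp add: card_image)
  qed
qed

section \<open>The Gale order and the necklace\<close>

text \<open>Translates domination by counting into entrywise comparison. If entry \<open>i\<close>
  of \<open>S\<close> exceeded entry \<open>i\<close> of \<open>T\<close>, then up to the latter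
  \<open>T\<close> would have at least \<open>i + 1\<close> elements and \<open>S\<close> at most
  \<open>i\<close>, indices starting at 0.\<close>

lemma list_all2_sorted_list_of_set_le:
  fixes S T :: "nat set"
  assumes fin: "finite S" "finite T" and card: "card S = card T"
    and count: "\<And>t. card {x\<in>T. x \<le> t} \<le> card {x\<in>S. x \<le> t}"
  shows "list_all2 (\<le>) (sorted_list_of_set S) (sorted_list_of_set T)"
proof (rule list_all2_all_nthI)
  let ?s = "sorted_list_of_set S" and ?t = "sorted_list_of_set T"
  show "length ?s = length ?t" using fin card by simp
  fix i assume "i < length ?s"
  then have i: "i < card S" "i < card T" using fin card by auto
  show "?s ! i \<le> ?t ! i"
  proof (rule ccontr)
    assume less: "\<not> ?s ! i \<le> ?t ! i"
    have sorted: "sorted ?s" "sorted ?t" by simp_all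
    have "(!) ?t ` {..i} \<subseteq> {x\<in>T. x \<le> ?t ! i}"
    proof clarsimp
      fix j assume "j \<le> i"
      with i fin have j: "j < length ?t" by simp
      then have "?t ! j \<in> set ?t" by (rule nth_mem)
      then show "?t ! j \<in> T \<and> ?t ! j \<le> ?t ! i"
        using sorted_nth_mono[OF sorted(2) \<open>j \<le> i\<close>] i fin by simp
    qed
    then have "card ((!) ?t ` {..i}) \<le> card {x\<in>T. x \<le> ?t ! i}"
      using fin by (intro card_mono) auto
    moreover have "inj_on ((!) ?t) {..i}"
      using i fin by (intro inj_on_nth) auto
    ultimately have "Suc i \<le> card {x\<in>T. x \<le> ?t ! i}"
      by (simp add: card_image)
    also have "\<dots> \<le> card {x\<in>S. x \<le> ?t ! i}" by (rule count)
    also have "{x\<in>S. x \<le> ?t ! i} \<subseteq> (!) ?s ` {..<i}"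
    proof
      fix x assume x: "x \<in> {x\<in>S. x \<le> ?t ! i}"
      then have "x \<in> set ?s" using fin by simp
      then obtain j where j: "j < length ?s" "x = ?s ! j" by (metis in_set_conv_nth)
      have "j < i"
      proof (rule ccontr)
        assume "\<not> j < i"
        then have "?s ! i \<le> ?s ! j"
          using j by (intro sorted_nth_mono[OF sorted(1)]) auto
        then show False using x j less by simp
      qed
      then show "x \<in> (!) ?s ` {..<i}" using j by auto
    qed
    then have "card {x\<in>S. x \<le> ?t ! i} \<le> card ((!) ?s ` {..<i})"
      by (intro card_mono) auto
    also have "\<dots> \<le> i" using card_image_le[of "{..<i}" "(!) ?s"] by simp
    finally show False by simp
  qed
qed

text \<open>The rotation shifts indices from \<open>a\<close> on to values below
  \<open>n - a\<close>, and smaller indices to values from \<open>n - a\<close> on.\<close>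

lemma inj_on_cyclic_pos:
  assumes "a < n"
  shows "inj_on (cyclic_pos n a) {..<n}"
proof -
  have "cyclic_pos n a j = (if a \<le> j then j - a else j + n - a)" if "j < n" for j
  proof (cases "a \<le> j")
    case True
    then have "j + n - a = (j - a) + n" by simp
    then have "cyclic_pos n a j = (j - a) mod n"
      unfolding cyclic_pos_def by (simp only: mod_add_self2)
    with True that show ?thesis by simp
  next
    case False
    with that assms show ?thesis unfolding cyclic_pos_def by simp
  qed
  then show ?thesis using assms by (auto simp: inj_on_def split: if_splits)
qed

lemma gale_le_antisym:
  assumes "a < n" "S \<subseteq> {..<n}" "T \<subseteq> {..<n}" "gale_le n a S T" "gale_le n a T S"
  shows "S = T"
proof -
  have fin: "finite S" "finite T" using assms finite_subset by blast+
  have "sorted_list_of_set (cyclic_pos n a ` S) = sorted_list_of_set (cyclic_pos n a ` T)"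
    using assms by (intro list_all2_antisym[of "(\<le>)" "(\<le>)"]) (auto simp: gale_le_def)
  then have "cyclic_pos n a ` S = cyclic_pos n a ` T"
    using fin by (metis finite_imageI set_sorted_list_of_set)
  then show ?thesis
    using inj_on_image_eq_iff[OF inj_on_cyclic_pos] assms by blast
qed

text \<open>Shows that the definite description in \<open>necklace\<close> denotes: a dominating
  basis for the weight \<open>cyclic_pos n a\<close> is Gale-minimal, and antisymmetry makes it
  unique.\<close>

lemma necklace_gale_le_basis:
  assumes "finite_matroid {..<n} M" "a < n" "B \<in> matroid_bases M"
  shows "gale_le n a (necklace n M a) B"
proof -
  interpret finite_matroid "{..<n}" M by fact
  let ?w = "cyclic_pos n a"
  have sub: "B \<subseteq> {..<n}" if "B \<in> matroid_bases M" for B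
    using that indep_subset_ground by (simp add: matroid_bases_def)
  obtain C where C: "C \<in> matroid_bases M"
    and dom: "\<And>B' t. B' \<in> matroid_bases M \<Longrightarrow> card {x\<in>B'. ?w x \<le> t} \<le> card {x\<in>C. ?w x \<le> t}"
    using ex_dominating_basis[of ?w] by blast
  have count: "card {x \<in> ?w ` B. x \<le> t} = card {x\<in>B. ?w x \<le> t}"
    if "B \<in> matroid_bases M" for B t
  proof -
    have "{x \<in> ?w ` B. x \<le> t} = ?w ` {x\<in>B. ?w x \<le> t}" by auto
    moreover have "inj_on ?w {x\<in>B. ?w x \<le> t}"
      using sub[OF that] by (intro inj_on_subset[OF inj_on_cyclic_pos[OF assms(2)]]) auto
    ultimately show ?thesis by (simp add: card_image)
  qed
  have card: "card (?w ` B) = card B" if "B \<in> matroid_bases M" for B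
    using sub[OF that] by (intro card_image inj_on_subset[OF inj_on_cyclic_pos[OF assms(2)]])
  have "gale_le n a C B'" if B': "B' \<in> matroid_bases M" for B'
    unfolding gale_le_def
    using sub[OF C] sub[OF B'] dom[OF B'] card_basis_eq[OF C B']
    by (intro list_all2_sorted_list_of_set_le)
       (auto simp: count[OF C] count[OF B'] card[OF C] card[OF B'] intro: finite_subset)
  then have "\<exists>!C. C \<in> matroid_bases M \<and> (\<forall>B' \<in> matroid_bases M. gale_le n a C B')"
    using C gale_le_antisym[OF assms(2)] sub by (intro ex1I[of _ C]) blast+
  from theI'[OF this] show ?thesis
    using assms(3) by (simp add: necklace_def)
qed

subsection \<open>Row spaces of matrices of full row rank\<close>

text \<open>Full column rank \<open>k\<close> makes \<open>A\<close> surjective onto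
  \<open>k\<close>-space, and surjectivity makes the rows distinct and independent, so the row space
  has dimension \<open>k\<close>.\<close>

lemma row_space_in_Gr:
  fixes A :: "real mat"
  assumes A: "A \<in> carrier_mat k n" and rank: "vec_space.rank k A = k"
  shows "vec_space.row_space n A \<in> Gr k n"
proof -
  interpret K: vec_space "TYPE(real)" k .
  interpret N: vec_space "TYPE(real)" n .
  have cols: "set (cols A) \<subseteq> carrier_vec k" using A cols_dim by blast
  have "K.span (set (cols A)) = carrier_vec k"
  proof -
    obtain S where S: "maximal S (\<lambda>T. T \<subseteq> set (cols A) \<and> K.lin_indpt T)"
      using maximal_exists_superset[of "set (cols A)" "\<lambda>T. T \<subseteq> set (cols A) \<and> K.lin_indpt T" "{}"]
      by (auto simp: K.lin_dep_def)
    then have S': "S \<subseteq> set (cols A)" "K.lin_indpt S" by (auto simp: maximal_def)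
    have "card S = k" using K.rank_card_indpt[OF A S] rank by simp
    then have "K.basis S"
      using S' cols finite_subset by (intro K.dim_li_is_basis) (auto simp: K.dim_is_n)
    then have "carrier_vec k \<subseteq> K.span (set (cols A))"
      using K.span_is_monotone[OF S'(1)] by (simp add: K.basis_def)
    then show ?thesis using K.span_is_subset2[of "set (cols A)"] cols by auto
  qed
  then have surj: "\<exists>x\<in>carrier_vec n. A *\<^sub>v x = y" if "y \<in> carrier_vec k" for y
    using that K.col_space_eq[OF A] A by (auto simp: K.col_space_def)
  have AT: "A\<^sup>T \<in> carrier_mat n k" using A by simp
  \<comment> \<open>Independence is stated for the set of rows, which would hide repetitions. A
    preimage of the \<open>i\<close>-th unit vector separates row \<open>i\<close> from the
    others.\<close>
  have dist: "distinct (cols A\<^sup>T)"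
  proof (unfold cols_transpose distinct_conv_nth, intro allI impI)
    fix i j assume ij: "i < length (rows A)" "j < length (rows A)" "i \<noteq> j"
    obtain x where x: "x \<in> carrier_vec n" "A *\<^sub>v x = unit_vec k i"
      using surj[of "unit_vec k i"] by auto
    have "row A i \<bullet> x = 1" "row A j \<bullet> x = 0"
      using arg_cong[OF x(2), of "\<lambda>v. v $ i"] arg_cong[OF x(2), of "\<lambda>v. v $ j"] ij A by auto
    then show "rows A ! i \<noteq> rows A ! j" using ij by auto
  qed
  have "N.lin_indpt (set (cols A\<^sup>T))"
  proof
    assume "N.lin_dep (set (cols A\<^sup>T))"
    then obtain v where v: "v \<in> carrier_vec k" "v \<noteq> 0\<^sub>v k" "A\<^sup>T *\<^sub>v v = 0\<^sub>v n"
      using N.lin_depE[OF AT _ dist] by blast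
    obtain x where x: "x \<in> carrier_vec n" "A *\<^sub>v x = v" using surj v(1) by blast
    \<comment> \<open>Moving \<open>A\<close> across the scalar product turns a relation
      \<open>v\<close> among the rows into a real vector of square norm 0.\<close>
    have "v \<bullet> v = (A *\<^sub>v x) \<bullet> v" using x by simp
    also have "\<dots> = (A\<^sup>T *\<^sub>v v) \<bullet> x"
      by (metis A AT comm_scalar_prod mult_mat_vec_carrier transpose_vec_mult_scalar v(1) x(1))
    also have "\<dots> = 0" using v x by simp
    finally show False using v conjugate_square_eq_0_vec[OF v(1)] by simp
  qed
  then have "N.rank A\<^sup>T = k" by (rule N.lin_indpt_full_rank[OF AT dist])
  moreover have "VectorSpace.subspace class_ring (N.row_space A) N.V"
    unfolding N.row_space_def using A by (intro N.span_is_subspace) (auto simp: rows_def)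
  ultimately show ?thesis
    by (simp add: Gr_def N.rank_def N.row_space_def)
qed

theorem proposition3p12:
  fixes k n :: nat and V :: "nat \<Rightarrow> nat set"
  assumes "\<And>i. i < k \<Longrightarrow> V i \<subseteq> {..<n}"
    and "positroid n (var_matroid k n V)"
  shows "\<forall>f. f dvd R_poly k n V \<longrightarrow>
           vanishing_locus k n V f \<subseteq>
             closed_positroid_variety k n (var_matroid k n V) -
             open_positroid_variety k n (var_matroid k n V)"
proof (intro allI impI subsetI)
  fix f W
  assume f: "f dvd R_poly k n V" and "W \<in> vanishing_locus k n V f"
  then obtain x where x: "eval_mpoly x f = 0"
    and W: "W = vec_space.row_space n (map_mat (eval_mpoly x) (var_mat k n V))"
    and rank: "vec_space.rank k (map_mat (eval_mpoly x) (var_mat k n V)) = k"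
    by (auto simp: vanishing_locus_def)
  let ?M = "var_matroid k n V" and ?X = "var_mat k n V"
  let ?F = "map_mat (\<lambda>p. Fraction_Field.Fract p 1) ?X"
  have X: "map_mat (eval_mpoly x) ?X \<in> carrier_mat k n" and F: "?F \<in> carrier_mat k n"
    by (simp_all add: var_mat_def)
  \<comment> \<open>The evaluated matrix is itself the witness with row space \<open>W\<close>. This
    serves both membership in the closed variety and exclusion from the open one.\<close>
  have plucker: "plucker_zero k n W I" if "eval_mpoly x (maximal_minor ?X I) = 0" for I
    unfolding plucker_zero_def
    using that X W maximal_minor_hom[OF comm_ring_hom_eval_mpoly] by metis
  have matroid: "finite_matroid {..<n} ?M"
    unfolding var_matroid_def by (rule finite_matroid_column_matroid[OF F])
  have closed: "W \<in> closed_positroid_variety k n ?M"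
    unfolding closed_positroid_variety_def
  proof (intro CollectI conjI allI impI)
    show "W \<in> Gr k n" unfolding W by (rule row_space_in_Gr[OF X rank])
    fix I assume I: "I \<subseteq> {..<n}" "card I = k" and "\<exists>b<n. \<not> gale_le n b (necklace n ?M b) I"
    then have "I \<notin> matroid_bases ?M" using necklace_gale_le_basis[OF matroid] by blast
    then have "maximal_minor ?F I = 0"
      using basis_if_maximal_minor_nonzero[OF F I] by (auto simp: var_matroid_def)
    \<comment> \<open>The embedding into the fraction field is injective, so the minor is the zero
      polynomial and vanishes at every \<open>x\<close>.\<close>
    then have "maximal_minor ?X I = 0"
      by (simp add: maximal_minor_hom[OF comm_ring_hom_Fract] Fract_eq_zero_iff)
    then show "plucker_zero k n W I" by (simp add: plucker eval_mpoly_0)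
  qed
  have "eval_mpoly x (R_poly k n V) = 0" using f x by (rule eval_mpoly_dvd)
  then have "eval_mpoly x (\<Prod>a<n. maximal_minor ?X (necklace n ?M a)) = 0"
    unfolding R_poly_def by (rule eval_mpoly_rad_eq_0)
  then obtain a where "a < n" "eval_mpoly x (maximal_minor ?X (necklace n ?M a)) = 0"
    by (auto simp: eval_mpoly_prod)
  then have "W \<notin> open_positroid_variety k n ?M"
    using plucker by (auto simp: open_positroid_variety_def)
  with closed show "W \<in> closed_positroid_variety k n ?M - open_positroid_variety k n ?M"
    by blast
qed

end
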